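(* Let $\{H_k:k<\omega\}$ be a class of finite graphs such that each $H_k$ is $d(k)$-regular, where both $d(k)\to\infty$ and $\operatorname{girth}(H_k)\to\infty$ as $k\to\infty$. Let $\mathcal{U}$ be a non-principal ultrafilter on $\omega$, $\mathcal{M}=\prod_{\mathcal{U}}H_k$, $\alpha=[\,|H_k|\,]_{\mathcal{U}}$ and $\beta=[d(k)]_{\mathcal{U}}$. If $E=\varphi(\mathcal{M},\bar a)\subseteq\mathcal{M}^1$ is a set definable (with parameters $\bar a$ from $\mathcal{M}$) by a first-order formula $\varphi(x,\bar y)$ in the language of graphs, then there exists a polynomial $p_E(t_1,t_2)\in\mathbb{Z}[t_1,t_2]$ such that $|E|=p_E(\alpha,\beta)$.
   Context: Graphs are simple; $\operatorname{girth}(H)$ is the length of a shortest cycle in $H$ (cycles have length $\geq 3$). For a definable set $X=\varphi(\mathcal{M}^n,\bar a)$ with $\bar a=[\bar a_k]_{\mathcal{U}}$, its non-standard cardinality is $|X|=[\,|\varphi(H_k^n,\bar a_k)|\,]_{\mathcal{U}}\in\mathbb{R}^{\mathcal{U}}$ (well defined by Łoś's theorem); polynomials are evaluated in the ordered ring $\mathbb{R}^{\mathcal{U}}$. *)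

theory Defs
  imports Main
begin

definition simple_graph :: "'a set \<Rightarrow> ('a \<Rightarrow> 'a \<Rightarrow> bool) \<Rightarrow> bool" where
  "simple_graph V E \<longleftrightarrow> finite V \<and> (\<forall>u v. E u v \<longrightarrow> u \<in> V \<and> v \<in> V)
     \<and> (\<forall>u v. E u v \<longrightarrow> E v u) \<and> (\<forall>v. \<not> E v v)"

definition regular :: "'a set \<Rightarrow> ('a \<Rightarrow> 'a \<Rightarrow> bool) \<Rightarrow> nat \<Rightarrow> bool" where
  "regular V E d \<longleftrightarrow> (\<forall>v\<in>V. card {u\<in>V. E v u} = d)"

definition has_cycle_of_length :: "'a set \<Rightarrow> ('a \<Rightarrow> 'a \<Rightarrow> bool) \<Rightarrow> nat \<Rightarrow> bool" where
  "has_cycle_of_length V E n \<longleftrightarrow> n \<ge> 3 \<and> (\<exists>xs. length xs = n \<and> distinct xs \<and> set xs \<subseteq> V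
     \<and> (\<forall>i. Suc i < n \<longrightarrow> E (xs ! i) (xs ! Suc i)) \<and> E (xs ! (n - 1)) (xs ! 0))"

text \<open>girth(H) > g, i.e. H has no cycle of length \<le> g (girth of an acyclic graph is \<infinity>).\<close>
definition girth_greater :: "'a set \<Rightarrow> ('a \<Rightarrow> 'a \<Rightarrow> bool) \<Rightarrow> nat \<Rightarrow> bool" where
  "girth_greater V E g \<longleftrightarrow> (\<forall>n\<le>g. \<not> has_cycle_of_length V E n)"

datatype fo = FEq nat nat | FAdj nat nat | FNeg fo | FConj fo fo | FEx nat fo

fun sat :: "'a set \<Rightarrow> ('a \<Rightarrow> 'a \<Rightarrow> bool) \<Rightarrow> fo \<Rightarrow> (nat \<Rightarrow> 'a) \<Rightarrow> bool" where
  "sat V E (FEq x y) \<sigma> \<longleftrightarrow> \<sigma> x = \<sigma> y"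
| "sat V E (FAdj x y) \<sigma> \<longleftrightarrow> E (\<sigma> x) (\<sigma> y)"
| "sat V E (FNeg \<phi>) \<sigma> \<longleftrightarrow> \<not> sat V E \<phi> \<sigma>"
| "sat V E (FConj \<phi> \<psi>) \<sigma> \<longleftrightarrow> sat V E \<phi> \<sigma> \<and> sat V E \<psi> \<sigma>"
| "sat V E (FEx x \<phi>) \<sigma> \<longleftrightarrow> (\<exists>v\<in>V. sat V E \<phi> (\<sigma>(x := v)))"

definition defset :: "'a set \<Rightarrow> ('a \<Rightarrow> 'a \<Rightarrow> bool) \<Rightarrow> fo \<Rightarrow> (nat \<Rightarrow> 'a) \<Rightarrow> 'a set" where
  "defset V E \<phi> a = {v \<in> V. sat V E \<phi> (\<lambda>i. if i = 0 then v else a (i - 1))}"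

definition nonprincipal_ultrafilter :: "nat filter \<Rightarrow> bool" where
  "nonprincipal_ultrafilter U \<longleftrightarrow> U \<noteq> bot
     \<and> (\<forall>P. eventually P U \<or> eventually (\<lambda>k. \<not> P k) U)
     \<and> (\<forall>n. \<not> eventually (\<lambda>k. k = n) U)"

end

theory Submission
  imports Defs "HOL-Computational_Algebra.Polynomial"
begin

text \<open>
  Let \<open>W\<^sub>r(a)\<close> be the set of end points of walks of length exactly \<open>r\<close> from \<open>a\<close>. In a tree
  with an edge this is the set of points whose distance from \<open>a\<close> is at most \<open>r\<close> and has the parity
  of \<open>r\<close>. The point of fixing the parity is that these "balls" are closed under intersection
  without half-integral centres: if \<open>m\<close> lies on the geodesic from \<open>a\<close> to \<open>b\<close>, at distance \<open>i\<close>
  from \<open>a\<close> and \<open>j\<close> from \<open>b\<close>, then \<open>W\<^sub>q(m)\<close> is the intersection of \<open>W\<^sub>q\<^sub>+\<^sub>i(a)\<close> and \<open>W\<^sub>q\<^sub>+\<^sub>j(b)\<close>.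
  All of this holds in regular graphs of large girth, where \<open>w\<^sub>r = |W\<^sub>r(a)|\<close> satisfies
  \<open>w\<^sub>r\<^sub>+\<^sub>2 = d w\<^sub>r\<^sub>+\<^sub>1 - (d - 1) w\<^sub>r\<close>.

  In the ultraproduct, inclusion-exclusion therefore shows that the set of \<open>v\<close> with prescribed
  truth values of finitely many conditions \<open>v \<in> W\<^sub>r(a\<^sub>i)\<close> has size \<open>c\<alpha> + p(\<beta>)\<close>, where \<open>c\<close> and \<open>p\<close>
  depend only on the relations \<open>W\<^sub>r\<close> among the \<open>a\<^sub>i\<close>. In particular such a set is empty over one
  tuple iff it is empty over every other tuple with the same relations. By saturation this gives a
  back-and-forth system, so first-order formulas depend only on the relations \<open>W\<^sub>r\<close>; again by
  saturation, a definable set is a finite union of sets of the above kind.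
\<close>

subsection \<open>Walks in regular graphs of large girth\<close>

lemma relpowp_split_at:
  fixes P :: "'a \<Rightarrow> 'a \<Rightarrow> bool"
  assumes "\<forall>i<n. P (f i) (f (Suc i))" "i \<le> j" "j \<le> n"
  shows "(P ^^ (j - i)) (f i) (f j)"
  unfolding relpowp_fun_conv
  using assms by (intro exI[of _ "\<lambda>l. f (i + l)"]) auto

lemma relpowp_shortcut:
  fixes P :: "'a \<Rightarrow> 'a \<Rightarrow> bool"
  assumes "\<forall>i<n. P (f i) (f (Suc i))" "i \<le> j" "j \<le> n" "f i = f j"
  shows "(P ^^ (n - (j - i))) (f 0) (f n)"
proof -
  have "(P ^^ (i - 0)) (f 0) (f i)" "(P ^^ (n - j)) (f j) (f n)"
    by (rule relpowp_split_at[where P = P and f = f, OF assms(1)]; use assms in simp)+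
  then have "(P ^^ (i + (n - j))) (f 0) (f n)"
    using assms(4) by (auto simp: relpowp_add)
  moreover have "i + (n - j) = n - (j - i)" using assms by auto
  ultimately show ?thesis by simp
qed

text \<open>A walk of minimal length repeats no vertex, because \<open>relpowp_shortcut\<close>
  would cut the loop out.\<close>

lemma relpowp_min_inj:
  fixes P :: "'a \<Rightarrow> 'a \<Rightarrow> bool"
  assumes "(P ^^ n) u v"
  obtains f k where "k \<le> n" "f 0 = u" "f k = v" "\<forall>i<k. P (f i) (f (Suc i))" "inj_on f {..k}"
proof -
  define k where "k = (LEAST k. (P ^^ k) u v)"
  have k: "(P ^^ k) u v" "k \<le> n" and least: "\<And>l. (P ^^ l) u v \<Longrightarrow> k \<le> l"
    unfolding k_def using assms by (auto intro: LeastI Least_le)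
  obtain f where f: "f 0 = u" "f k = v" "\<forall>i<k. P (f i) (f (Suc i))"
    using k(1) unfolding relpowp_fun_conv by auto
  have "f i \<noteq> f j" if "i < j" "j \<le> k" for i j
  proof
    assume "f i = f j"
    then have "(P ^^ (k - (j - i))) u v"
      using relpowp_shortcut[where P = P and f = f, OF f(3), of i j] that f by auto
    from least[OF this] show False using that by auto
  qed
  then have "inj_on f {..k}"
    by (intro inj_onI) (metis atMost_iff linorder_neqE_nat)
  with k f that show ?thesis by blast
qed

locale regular_graph =
  fixes V :: "'a set" and E :: "'a \<Rightarrow> 'a \<Rightarrow> bool" and d :: nat
  assumes graph: "simple_graph V E" and reg: "regular V E d" and deg_pos: "d \<ge> 1"
begin

lemma fin: "finite V" and edge_in: "E u v \<Longrightarrow> u \<in> V \<and> v \<in> V"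
  and edge_sym: "E u v \<Longrightarrow> E v u" and no_loop: "\<not> E v v"
  using graph unfolding simple_graph_def by blast+

lemma card_nbrs: "v \<in> V \<Longrightarrow> card {u. E v u} = d"
proof -
  assume "v \<in> V"
  moreover have "{u. E v u} = {u \<in> V. E v u}" using edge_in by auto
  ultimately show ?thesis using reg unfolding regular_def by simp
qed

lemma walk_sym: "(E ^^ r) x y \<Longrightarrow> (E ^^ r) y x"
proof (induction r arbitrary: y)
  case (Suc r)
  then obtain z where "(E ^^ r) x z" "E z y" by auto
  then show ?case using Suc.IH edge_sym relpowp_Suc_I2 by metis
qed simp

lemma walk_commute: "(E ^^ r) x y \<longleftrightarrow> (E ^^ r) y x"
  using walk_sym by blast

lemma walk_in: "(E ^^ r) x y \<Longrightarrow> x \<in> V \<Longrightarrow> y \<in> V"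
  by (cases r) (auto dest: edge_in)

text \<open>Every vertex has a neighbour, as \<open>d \<ge> 1\<close>; stepping to it and back adds
  two steps to a walk. Hence balls of one parity grow with the radius.\<close>

lemma walk_pad: 
  assumes "(E ^^ r) x y" "x \<in> V" "r \<le> s" "even (r + s)"
  shows "(E ^^ s) x y"
proof -
  have y: "y \<in> V" using walk_in assms by blast
  have step: "(E ^^ Suc (Suc n)) x y" if "(E ^^ n) x y" for n
  proof -
    have "{u. E y u} \<noteq> {}" using card_nbrs[OF y] deg_pos by force
    then obtain u where "E y u" by auto
    then show ?thesis using that edge_sym by (meson relpowp_Suc_I)
  qed
  have "(E ^^ (r + 2 * j)) x y" for j
    by (induction j) (use assms(1) step in \<open>auto simp del: relpowp.simps\<close>)
  moreover obtain j where "s = r + 2 * j"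
    using assms(3,4) by (metis even_add even_diff_nat evenE le_add_diff_inverse)
  ultimately show ?thesis by simp
qed

text \<open>Strong induction: an odd closed walk without repetition is a cycle, and a repetition
  splits it into two shorter closed walks, one of which has odd length.\<close>

lemma no_odd_closed_walk:
  assumes g: "girth_greater V E L" and "n \<le> L" "odd n"
  shows "\<not> (E ^^ n) x x"
  using assms(2,3)
proof (induction n arbitrary: x rule: less_induct)
  case (less n)
  show ?case
  proof
    assume "(E ^^ n) x x"
    then obtain f where f: "f 0 = x" "f n = x" "\<forall>i<n. E (f i) (f (Suc i))"
      unfolding relpowp_fun_conv by auto
    show False
    proof (cases "inj_on f {..<n}")
      case True
      have "n \<noteq> 1" using f no_loop by auto
      then have n3: "n \<ge> 3" using less.prems by (cases n rule: nat.exhaust) (auto elim!: oddE)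
      have "has_cycle_of_length V E n"
        unfolding has_cycle_of_length_def
      proof (intro conjI n3 exI[of _ "map f [0..<n]"])
        show "distinct (map f [0..<n])" using True by (simp add: distinct_map atLeast0LessThan)
        show "set (map f [0..<n]) \<subseteq> V" using f edge_in by auto
        show "\<forall>i. Suc i < n \<longrightarrow> E (map f [0..<n] ! i) (map f [0..<n] ! Suc i)" using f by auto
        have "Suc (n - 1) = n" using n3 by simp
        then have "E (f (n - 1)) (f n)" using f(3) by (metis lessI)
        then show "E (map f [0..<n] ! (n - 1)) (map f [0..<n] ! 0)" using f(1,2) n3 by simp
      qed simp
      then show False using g less.prems unfolding girth_greater_def by blast
    next
      case False
      then obtain i j where ij: "i < j" "j < n" "f i = f j"
        unfolding inj_on_def by (metis lessThan_iff linorder_neqE_nat)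
      have 1: "(E ^^ (j - i)) (f i) (f i)" using relpowp_split_at[where P = E and f = f, OF f(3), of i j] ij by simp
      have 2: "(E ^^ (n - (j - i))) x x" using relpowp_shortcut[where P = E and f = f, OF f(3), of i j] ij f by simp
      have "odd (j - i) \<or> odd (n - (j - i))" using less.prems ij by auto
      moreover have "j - i < n" "n - (j - i) < n" "j - i \<le> L" "n - (j - i) \<le> L"
        using ij less.prems by linarith+
      ultimately show False
        using less.IH[of "j - i" "f i"] less.IH[of "n - (j - i)" x] 1 2 by blast
    qed
  qed
qed

text \<open>One walk followed by the reverse of the other is closed. Up to the girth bound the graph
  thus behaves as if it were bipartite.\<close>

lemma walk_parity:
  assumes "girth_greater V E L" "(E ^^ r) x y" "(E ^^ s) x y" "r + s \<le> L"
  shows "even (r + s)"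
proof -
  have "(E ^^ (r + s)) x x" unfolding relpowp_add using assms walk_sym by blast
  then show ?thesis using no_odd_closed_walk assms by blast
qed

section \<open>Walks avoiding a point, and separation as in a tree\<close>

abbreviation edge_off :: "'a \<Rightarrow> 'a \<Rightarrow> 'a \<Rightarrow> bool" where
  "edge_off m u v \<equiv> E u v \<and> u \<noteq> m \<and> v \<noteq> m"

lemma walk_off_sym: "(edge_off m ^^ r) x y \<Longrightarrow> (edge_off m ^^ r) y x"
proof (induction r arbitrary: y)
  case (Suc r)
  then obtain z where "(edge_off m ^^ r) x z" "edge_off m z y" by auto
  then show ?case using Suc.IH[of z] edge_sym relpowp_Suc_I2[of "edge_off m" y z r x] by blast
qed simp

lemma walk_through_or_off:
  assumes "(E ^^ n) x y"
  shows "(\<exists>j\<le>n. (E ^^ j) x m \<and> (E ^^ (n - j)) m y) \<or> (edge_off m ^^ n) x y"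
proof -
  obtain f where f: "f 0 = x" "f n = y" "\<forall>i<n. E (f i) (f (Suc i))"
    using assms unfolding relpowp_fun_conv by auto
  show ?thesis
  proof (cases "\<exists>j\<le>n. f j = m")
    case True
    then obtain j where "j \<le> n" "f j = m" by auto
    then show ?thesis
      using relpowp_split_at[where P = E and f = f, OF f(3), of 0 j] relpowp_split_at[where P = E and f = f, OF f(3), of j n] f by auto
  next
    case False
    then have "\<forall>i<n. edge_off m (f i) (f (Suc i))" using f(3) by (metis Suc_leI less_imp_le_nat)
    then show ?thesis using f unfolding relpowp_fun_conv by blast
  qed
qed

text \<open>A shortest walk off \<open>m\<close> from \<open>u\<close> to \<open>v\<close>, closed
  up through \<open>m\<close>, would be a cycle of length \<open>k + 2\<close>, which is at least 3
  when \<open>u\<close> and \<open>v\<close> differ.\<close>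

lemma no_walk_off_between_nbrs:
  assumes g: "girth_greater V E L" and w: "(edge_off m ^^ n) u v"
    and "E m u" "E m v" "n + 2 \<le> L"
  shows "u = v"
proof (rule ccontr)
  assume "u \<noteq> v"
  obtain f k where f: "k \<le> n" "f 0 = u" "f k = v" "\<forall>i<k. edge_off m (f i) (f (Suc i))"
    "inj_on f {..k}"
    using relpowp_min_inj[OF w] by metis
  have k: "k \<ge> 1" using \<open>u \<noteq> v\<close> f by (cases k) auto
  define xs where "xs = m # map f [0..<Suc k]"
  have um: "u \<noteq> m" "v \<noteq> m" using assms(3,4) no_loop by auto
  have "f i \<noteq> m" if "i \<le> k" for i
    using f(3,4) that um by (cases "i = k") auto
  then have dist: "distinct xs"
    unfolding xs_def using f(5) by (auto simp: distinct_map atLeast0LessThan lessThan_Suc_atMost simp del: upt_Suc)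
  have inV: "f i \<in> V" if "i \<le> k" for i
    using f(3,4) that edge_in assms(4) by (metis le_neq_implies_less)
  have "E (xs ! i) (xs ! Suc i)" if "Suc i < k + 2" for i
    using that assms(3) f(2,4) unfolding xs_def by (cases i) (auto simp del: upt_Suc)
  moreover have "E (xs ! (k + 2 - 1)) (xs ! 0)"
    unfolding xs_def using f edge_sym assms(4) by (auto simp del: upt_Suc)
  moreover have "set xs \<subseteq> V" "length xs = k + 2"
    unfolding xs_def using inV assms(3) edge_in by auto
  ultimately have "has_cycle_of_length V E (k + 2)"
    unfolding has_cycle_of_length_def using k dist by (intro conjI exI[of _ xs]) auto
  then show False using g f(1) assms(5) unfolding girth_greater_def by auto
qed

text \<open>A point \<open>m\<close> of a geodesic separates its end points, as in a tree: a walk missing \<open>m\<close>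
  would join the two geodesic neighbours of \<open>m\<close> and close up to a short cycle.\<close>

lemma geodesic_point_separates:
  assumes g: "girth_greater V E L" and am: "(E ^^ i) a m" and mb: "(E ^^ (l - i)) m b"
    and i: "0 < i" "i < l" and min: "\<And>q. q < l \<Longrightarrow> \<not> (E ^^ q) a b"
    and L: "n + l \<le> L"
  shows "\<not> (edge_off m ^^ n) a b"
proof
  assume w: "(edge_off m ^^ n) a b"
  obtain i' where i': "i = Suc i'" using i by (cases i) auto
  obtain k' where k': "l - i = Suc k'" using i by (cases "l - i") auto
  obtain u where u: "(E ^^ i') a u" "E u m" using am i' by auto
  obtain v where v: "E m v" "(E ^^ k') v b" using mb k' by (metis relpowp_Suc_D2)
  have short: False if "(E ^^ j) a m" "(E ^^ j') m b" "j + j' < l" for j j'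
    using min[of "j + j'"] that unfolding relpowp_add by blast
  have "u \<noteq> v"
  proof
    assume "u = v"
    then have "(E ^^ (i' + k')) a b" unfolding relpowp_add using u v by blast
    then show False using min[of "i' + k'"] i' k' by auto
  qed
  \<comment> \<open>The geodesic pieces on both sides of \<open>m\<close> avoid \<open>m\<close>: an
    additional visit would give a walk from \<open>a\<close> to \<open>b\<close> shorter than
    \<open>l\<close>.\<close>
  have au: "(edge_off m ^^ i') a u"
  proof (rule ccontr)
    assume "\<not> ?thesis"
    then obtain j where "j \<le> i'" "(E ^^ j) a m" using walk_through_or_off[OF u(1), of m] by auto
    moreover from this have "j + (l - i) < l" using i' i by linarith
    ultimately show False using short mb by blast
  qed
  have vb: "(edge_off m ^^ k') v b"
  proof (rule ccontr)
    assume "\<not> ?thesis"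
    then obtain j where "j \<le> k'" "(E ^^ (k' - j)) m b"
      using walk_through_or_off[OF v(2), of m] by auto
    moreover from this have "i + (k' - j) < l" using k' i by linarith
    ultimately show False using short am by blast
  qed
  \<comment> \<open>From \<open>u\<close> back to \<open>a\<close>, along the assumed walk to
    \<open>b\<close>, and back to \<open>v\<close>.\<close>
  have "(edge_off m ^^ (i' + n + k')) u v"
    using relpowp_trans[OF relpowp_trans[OF walk_off_sym[OF au] w] walk_off_sym[OF vb]] .
  moreover have "i' + n + k' + 2 \<le> L" using i' k' i L by linarith
  ultimately show False
    using no_walk_off_between_nbrs[OF g _ edge_sym[OF u(2)] v(1)] \<open>u \<noteq> v\<close> by blast
qed

text \<open>If the walks from \<open>a\<close> and \<open>b\<close> to \<open>x\<close> both avoided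
  \<open>m\<close>, they would join \<open>a\<close> to \<open>b\<close> off \<open>m\<close>,
  against \<open>geodesic_point_separates\<close>. So one of them meets \<open>m\<close>, and its
  part between \<open>m\<close> and \<open>x\<close> can be padded to length
  \<open>q\<close>.\<close>

lemma walk_from_geodesic_point:
  assumes g: "girth_greater V E L" and "a \<in> V" and am: "(E ^^ i) a m" and mb: "(E ^^ (l - i)) m b"
    and "i \<le> l" and min: "\<And>q. q < l \<Longrightarrow> \<not> (E ^^ q) a b"
    and L: "2 * q + 2 * l \<le> L"
  shows "(E ^^ q) m x \<longleftrightarrow> (E ^^ (q + i)) a x \<and> (E ^^ (q + (l - i))) b x"
proof
  assume "(E ^^ q) m x"
  from relpowp_trans[OF am this] relpowp_trans[OF walk_sym[OF mb] this]
  show "(E ^^ (q + i)) a x \<and> (E ^^ (q + (l - i))) b x" by (simp only: add.commute)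
next
  assume x: "(E ^^ (q + i)) a x \<and> (E ^^ (q + (l - i))) b x"
  have mV: "m \<in> V" using walk_in am \<open>a \<in> V\<close> by blast
  have no_am: "\<not> (E ^^ p) a m" if "p < i" for p
    using min[of "p + (l - i)"] that mb \<open>i \<le> l\<close> relpowp_trans[of p E a m "l - i" b] by auto
  have no_mb: "\<not> (E ^^ p) m b" if "p < l - i" for p
    using min[of "i + p"] that am \<open>i \<le> l\<close> relpowp_trans[of i E a m p b] by auto
  \<comment> \<open>Minimality gives \<open>i \<le> j\<close> and \<open>j\<close> has the parity of
    \<open>i\<close>, so the rest of the walk has length at most \<open>q\<close> and the parity of
    \<open>q\<close>.\<close>
  have via_a: "(E ^^ q) m x" if "(E ^^ j) a m" "(E ^^ (q + i - j)) m x" "j \<le> q + i" for j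
  proof (rule walk_pad[OF that(2) mV])
    have "i \<le> j" using no_am that(1) by (meson not_le)
    moreover have "even (i + j)" using walk_parity[OF g am that(1)] L \<open>i \<le> l\<close> that(3) by simp
    ultimately show "q + i - j \<le> q" "even (q + i - j + q)" using that(3) by (auto simp: even_diff_nat)
  qed
  have via_b: "(E ^^ q) m x" if "(E ^^ (q + (l - i) - j)) m b" "(E ^^ j) x m" "j \<le> q + (l - i)" for j
  proof (rule walk_pad[OF walk_sym[OF that(2)] mV])
    have "l - i \<le> q + (l - i) - j" using no_mb that(1) by (meson not_le)
    moreover have "even ((l - i) + (q + (l - i) - j))"
      using walk_parity[OF g mb that(1)] L \<open>i \<le> l\<close> that(3) by simp
    ultimately show "j \<le> q" "even (j + q)" using that(3) by (auto simp: even_diff_nat)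
  qed
  show "(E ^^ q) m x"
  proof (cases "0 < i \<and> i < l")
    case True
    show ?thesis
    proof (rule ccontr)
      assume neg: "\<not> ?thesis"
      have "(edge_off m ^^ (q + i)) a x"
        using walk_through_or_off[of "q + i" a x m] x via_a neg by blast
      moreover have "(edge_off m ^^ (q + (l - i))) x b"
      proof (rule ccontr)
        assume "\<not> ?thesis"
        then obtain j where "j \<le> q + (l - i)" "(E ^^ j) x m" "(E ^^ (q + (l - i) - j)) m b"
          using walk_through_or_off[of "q + (l - i)" x b m] x walk_sym by blast
        then show False using via_b neg by blast
      qed
      ultimately have "(edge_off m ^^ ((q + i) + (q + (l - i)))) a b"
        by (rule relpowp_trans)
      then show False
        using geodesic_point_separates[OF g am mb _ _ min] True L by simp
    qed
  next
    \<comment> \<open>Here \<open>m\<close> is an end of the geodesic, and one of the two conditions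
      is the claim itself.\<close>
    case False
    then show ?thesis using x am mb \<open>i \<le> l\<close> by (cases "i = 0") auto
  qed
qed

section \<open>Sizes of balls\<close>

text \<open>Walks of length \<open>Suc r\<close> from \<open>a\<close> to \<open>y\<close> and
  \<open>z\<close> cannot pass through \<open>x\<close>, as \<open>x\<close> is not reached in
  \<open>r\<close> steps. So they join two neighbours of \<open>x\<close> off
  \<open>x\<close>.\<close>

lemma unique_predecessor:
  assumes g: "girth_greater V E L" and L: "2 * r + 4 \<le> L" and aV: "a \<in> V"
    and y: "(E ^^ Suc r) a y" "E y x" "\<not> (E ^^ r) a x"
    and z: "(E ^^ Suc r) a z" "E z x"
  shows "y = z"
proof -
  have off: "(edge_off x ^^ Suc r) a u" if u: "(E ^^ Suc r) a u" "E u x" for u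
  proof (rule ccontr)
    assume "\<not> ?thesis"
    then obtain j where j: "j \<le> Suc r" "(E ^^ j) a x" "(E ^^ (Suc r - j)) x u"
      using walk_through_or_off[OF u(1), of x] by blast
    \<comment> \<open>The piece from \<open>x\<close> to its neighbour \<open>u\<close> has odd
      length, so \<open>x\<close> is reached in \<open>j \<le> r\<close> steps with the parity of
      \<open>r\<close>; padding to \<open>r\<close> contradicts the choice of
      \<open>x\<close>.\<close>
    have "even (Suc r - j + 1)"
      by (rule walk_parity[OF g j(3)]) (use edge_sym[OF u(2)] L in auto)
    then have "odd (Suc r - j)" by simp
    then have "j \<le> r" "even (j + r)" using j(1) by (cases "j = Suc r"; auto)+
    then show False using walk_pad[OF j(2) aV] y(3) by blast
  qed
  have "(edge_off x ^^ (Suc r + Suc r)) y z"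
    by (rule relpowp_trans[OF walk_off_sym[OF off[OF y(1,2)]] off[OF z]])
  moreover have "Suc r + Suc r + 2 \<le> L" using L by simp
  ultimately show ?thesis
    using no_walk_off_between_nbrs[OF g _ edge_sym[OF y(2)] edge_sym[OF z(2)]] by blast
qed

text \<open>Double count the edges between the balls of radius \<open>r + 1\<close> and
  \<open>r + 2\<close>. A point of the former has all \<open>d\<close> neighbours in the latter; a
  point of the latter has \<open>d\<close> neighbours in the former if it lies in the ball of radius
  \<open>r\<close>, and exactly one otherwise.\<close>

lemma card_walk_rec:
  assumes g: "girth_greater V E L" and L: "2 * r + 4 \<le> L" and aV: "a \<in> V"
  shows "int (card {x. (E ^^ Suc (Suc r)) a x}) =
     int d * int (card {x. (E ^^ Suc r) a x}) - (int d - 1) * int (card {x. (E ^^ r) a x})"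
proof -
  define W where "W r = {x. (E ^^ r) a x}" for r
  have finW: "finite (W r)" for r
    unfolding W_def using walk_in aV by (intro finite_subset[OF _ fin]) auto
  have W_V: "W r \<subseteq> V" for r unfolding W_def using walk_in aV by auto
  have sub: "W r \<subseteq> W (Suc (Suc r))" unfolding W_def using walk_pad[OF _ aV, of r _ "Suc (Suc r)"] by auto
  have "(\<Sum>y\<in>W (Suc r). card {x \<in> W (Suc (Suc r)). E y x}) =
        (\<Sum>x\<in>W (Suc (Suc r)). card {y \<in> W (Suc r). E y x})"
    by (rule sum_multicount_gen[symmetric]) (use finW in auto)
  moreover have "{x \<in> W (Suc (Suc r)). E y x} = {x. E y x}" if "y \<in> W (Suc r)" for y
    using that unfolding W_def by (auto simp del: relpowp.simps intro: relpowp_Suc_I)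
  then have "card {x \<in> W (Suc (Suc r)). E y x} = d" if "y \<in> W (Suc r)" for y
    using that card_nbrs W_V by (metis subsetD)
  moreover have "card {y \<in> W (Suc r). E y x} = d" if "x \<in> W r" for x
  proof -
    have "{y \<in> W (Suc r). E y x} = {y. E x y}"
      using that edge_sym unfolding W_def by (auto simp del: relpowp.simps intro: relpowp_Suc_I)
    then show ?thesis using card_nbrs W_V that by (metis subsetD)
  qed
  moreover have "card {y \<in> W (Suc r). E y x} = 1" if "x \<in> W (Suc (Suc r)) - W r" for x
  proof -
    from that obtain y where y: "(E ^^ Suc r) a y" "E y x" "\<not> (E ^^ r) a x"
      unfolding W_def by auto
    have "z = y" if "(E ^^ Suc r) a z" "E z x" for z
      by (rule unique_predecessor[OF g L aV y that, symmetric])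
    then have "{y \<in> W (Suc r). E y x} = {y}"
      using y unfolding W_def by blast
    then show ?thesis by simp
  qed
  ultimately have "card (W (Suc r)) * d = (\<Sum>x\<in>W (Suc (Suc r)). if x \<in> W r then d else 1)"
    by (auto simp: sum.If_cases intro!: sum.cong)
  also have "\<dots> = d * card (W r) + (card (W (Suc (Suc r))) - card (W r))"
    using sub finW
    by (simp add: sum.If_cases Int_absorb1 card_Diff_subset Diff_eq[symmetric] flip: set_diff_eq)
  finally have "card (W (Suc r)) * d = d * card (W r) + (card (W (Suc (Suc r))) - card (W r))" .
  moreover have "card (W r) \<le> card (W (Suc (Suc r)))" using sub finW card_mono by blast
  ultimately show ?thesis unfolding W_def[symmetric]
    by (simp add: algebra_simps of_nat_diff flip: of_nat_mult of_nat_add)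
qed

end

text \<open>The indeterminate stands for the degree, and \<open>[:-1, 1:]\<close> for the degree
  minus one.\<close>

fun walk_poly :: "nat \<Rightarrow> int poly" where
  "walk_poly 0 = 1"
| "walk_poly (Suc 0) = [:0, 1:]"
| "walk_poly (Suc (Suc r)) = [:0, 1:] * walk_poly (Suc r) - [:-1, 1:] * walk_poly r"

lemma (in regular_graph) card_walk:
  assumes "girth_greater V E L" "2 * r \<le> L" "a \<in> V"
  shows "int (card {x. (E ^^ r) a x}) = poly (walk_poly r) (int d)"
  using assms
proof (induction r rule: walk_poly.induct)
  case 1
  then show ?case by simp
next
  case 2
  have "relcompp (=) E a = E a" by auto
  then show ?case using card_nbrs[OF 2(3)] by simp
next
  case (3 r)
  then show ?case using card_walk_rec[of L r a]
    by (simp add: algebra_simps del: relpowp.simps)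
qed

subsection \<open>Counting in the ultraproduct\<close>

text \<open>The graph conditions are asked \<open>U\<close>-almost everywhere only, since the degree
  may vanish for small \<open>k\<close>.\<close>

locale graph_ultraproduct =
  fixes V :: "nat \<Rightarrow> 'a set" and E :: "nat \<Rightarrow> 'a \<Rightarrow> 'a \<Rightarrow> bool" and d :: "nat \<Rightarrow> nat"
    and U :: "nat filter"
  assumes regular_graph: "eventually (\<lambda>k. regular_graph (V k) (E k) (d k)) U"
    and girth: "\<And>L. eventually (\<lambda>k. girth_greater (V k) (E k) L) U"
    and nontrivial: "U \<noteq> bot"
    and ultra: "\<And>P. eventually P U \<or> eventually (\<lambda>k. \<not> P k) U"
    and free: "\<And>n. eventually (\<lambda>k. n \<le> k) U"
begin

text \<open>Elements of the ultraproduct are represented by sequences, without passing to the quotient.\<close>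

definition W :: "nat \<Rightarrow> (nat \<Rightarrow> 'a) \<Rightarrow> (nat \<Rightarrow> 'a) \<Rightarrow> bool" where
  "W r a b \<longleftrightarrow> eventually (\<lambda>k. (E k ^^ r) (a k) (b k)) U"

definition elem :: "(nat \<Rightarrow> 'a) \<Rightarrow> bool" where
  "elem a \<longleftrightarrow> eventually (\<lambda>k. a k \<in> V k) U"

lemma eventually_not_iff: "eventually (\<lambda>k. \<not> P k) U \<longleftrightarrow> \<not> eventually P U"
proof
  assume "eventually (\<lambda>k. \<not> P k) U"
  moreover have False if "eventually (\<lambda>k. \<not> P k) U" "eventually P U"
    using eventually_conj[OF that] nontrivial by (simp add: trivial_limit_def)
  ultimately show "\<not> eventually P U" by blast
qed (use ultra in blast)

lemma eventually_decide: "eventually (\<lambda>k. P k \<longleftrightarrow> eventually P U) U"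
  using ultra[of P] eventually_not_iff[of P] by (cases "eventually P U") auto

lemma eventually_iff_cong:
  assumes "eventually (\<lambda>k. P k \<longleftrightarrow> Q k) U"
  shows "eventually P U \<longleftrightarrow> eventually Q U"
  using assms by (intro iffI; elim eventually_rev_mp) (auto elim: eventually_mono)

lemma W_commute: "W r a b \<longleftrightarrow> W r b a"
  unfolding W_def
  by (rule eventually_iff_cong, rule eventually_mono[OF regular_graph])
    (rule regular_graph.walk_commute)

lemma W_self:
  assumes "elem a"
  shows "W r a a \<longleftrightarrow> even r"
proof -
  have "eventually (\<lambda>k. (E k ^^ r) (a k) (a k) \<longleftrightarrow> even r) U"
    using regular_graph girth[of r] assms[unfolded elem_def]
  proof eventually_elim
    case (elim k)
    interpret regular_graph "V k" "E k" "d k" by fact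
    show ?case using no_odd_closed_walk[OF elim(2), of r] walk_pad[of 0 "a k" "a k" r] elim by auto
  qed
  then show ?thesis
    unfolding W_def by (subst eventually_iff_cong) (use nontrivial in auto)
qed

lemma W_parity:
  assumes "W r a b" "W s a b"
  shows "even (r + s)"
proof -
  have "eventually (\<lambda>k. even (r + s)) U"
    using regular_graph girth[of "r + s"] assms[unfolded W_def]
  proof eventually_elim
    case (elim k)
    then show ?case using regular_graph.walk_parity[OF elim(1,2), of r _ _ s] by blast
  qed
  then show ?thesis using nontrivial by auto
qed

lemma eventually_walks_disjoint:
  assumes "\<not> W (r + s) a b"
  shows "eventually (\<lambda>k. \<forall>v. \<not> ((E k ^^ r) (a k) v \<and> (E k ^^ s) (b k) v)) U"
  using regular_graph assms[unfolded W_def, folded eventually_not_iff]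
proof eventually_elim
  case (elim k)
  then show ?case using regular_graph.walk_sym[OF elim(1)] by (meson relpowp_trans)
qed

lemma eventually_walks_subset:
  assumes "elem b" "W l a b" "r + l \<le> s" "even (r + s + l)"
  shows "eventually (\<lambda>k. \<forall>v. (E k ^^ r) (a k) v \<longrightarrow> (E k ^^ s) (b k) v) U"
  using regular_graph assms(1,2)[unfolded W_def elem_def]
proof eventually_elim
  case (elim k)
  interpret regular_graph "V k" "E k" "d k" by fact
  show ?case
  proof (intro allI impI)
    fix v assume "(E k ^^ r) (a k) v"
    then have "(E k ^^ (l + r)) (b k) v" using elim walk_sym by (meson relpowp_trans)
    then show "(E k ^^ s) (b k) v" by (rule walk_pad) (use elim assms in auto)
  qed
qed

text \<open>A point of a geodesic is recorded through the property used later, the intersection of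
  balls. The radius \<open>q\<close> is quantified outside \<open>eventually\<close>, as the girth
  required grows with \<open>q\<close>.\<close>

definition between :: "nat \<Rightarrow> nat \<Rightarrow> (nat \<Rightarrow> 'a) \<Rightarrow> (nat \<Rightarrow> 'a) \<Rightarrow> (nat \<Rightarrow> 'a) \<Rightarrow> bool" where
  "between i j a b m \<longleftrightarrow> elem m \<and> (\<forall>q. eventually (\<lambda>k. \<forall>x. (E k ^^ q) (m k) x \<longleftrightarrow>
     (E k ^^ (q + i)) (a k) x \<and> (E k ^^ (q + j)) (b k) x) U)"

text \<open>A point \<open>m k\<close> chosen on a shortest walk in almost every graph serves all
  \<open>q\<close>, because the girth eventually exceeds the bound of
  \<open>walk_from_geodesic_point\<close>.\<close>

lemma ex_between:
  assumes "elem a" "W (i + j) a b" "\<And>q. q < i + j \<Longrightarrow> \<not> W q a b"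
  obtains m where "between i j a b m"
proof -
  define m where "m = (\<lambda>k. SOME x. (E k ^^ i) (a k) x \<and> (E k ^^ j) x (b k))"
  have m: "eventually (\<lambda>k. (E k ^^ i) (a k) (m k) \<and> (E k ^^ j) (m k) (b k)) U"
    using assms(2) unfolding W_def
  proof eventually_elim
    case (elim k)
    then have "\<exists>x. (E k ^^ i) (a k) x \<and> (E k ^^ j) x (b k)" by (auto simp: relpowp_add)
    then show ?case unfolding m_def by (rule someI_ex)
  qed
  have "elem m"
    using regular_graph m assms(1) unfolding elem_def
    by eventually_elim (blast intro: regular_graph.walk_in)
  have min: "eventually (\<lambda>k. \<forall>q\<in>{..<i + j}. \<not> (E k ^^ q) (a k) (b k)) U"
    using assms(3) by (intro eventually_ball_finite) (auto simp: W_def eventually_not_iff)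
  have "eventually (\<lambda>k. \<forall>x. (E k ^^ q) (m k) x \<longleftrightarrow>
     (E k ^^ (q + i)) (a k) x \<and> (E k ^^ (q + j)) (b k) x) U" for q
    using regular_graph girth[of "2 * q + 2 * (i + j)"] m min assms(1)[unfolded elem_def]
  proof eventually_elim
    case (elim k)
    then show ?case
      using regular_graph.walk_from_geodesic_point[OF elim(1,2,5), of i "m k" "i + j" "b k" q] by auto
  qed
  with \<open>elem m\<close> that show ?thesis unfolding between_def by blast
qed

lemma W_between:
  assumes "between i j a b m"
  shows "W q m x \<longleftrightarrow> W (q + i) a x \<and> W (q + j) b x"
proof -
  have "eventually (\<lambda>k. (E k ^^ q) (m k) (x k) \<longleftrightarrow>
     (E k ^^ (q + i)) (a k) (x k) \<and> (E k ^^ (q + j)) (b k) (x k)) U"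
    using assms[unfolded between_def, THEN conjunct2, rule_format, of q]
    by (rule eventually_mono) blast
  then show ?thesis unfolding W_def eventually_conj_iff[symmetric] by (rule eventually_iff_cong)
qed

section \<open>Sizes of Boolean combinations of balls\<close>

definition has_size :: "(nat \<Rightarrow> 'a set) \<Rightarrow> int \<Rightarrow> int poly \<Rightarrow> bool" where
  "has_size X c p \<longleftrightarrow>
     eventually (\<lambda>k. int (card (X k)) = c * int (card (V k)) + poly p (int (d k))) U"

lemma has_size_cong:
  assumes "eventually (\<lambda>k. X k = Y k) U"
  shows "has_size X c p \<longleftrightarrow> has_size Y c p"
  unfolding has_size_def by (rule eventually_iff_cong, rule eventually_mono[OF assms]) simp

text \<open>Both sets share one \<open>c\<close> and one \<open>p\<close>. For \<open>X = Y\<close>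
  this says that a size exists.\<close>

definition same_size :: "(nat \<Rightarrow> 'a set) \<Rightarrow> (nat \<Rightarrow> 'a set) \<Rightarrow> bool" where
  "same_size X Y \<longleftrightarrow> (\<exists>c p. has_size X c p \<and> has_size Y c p)"

lemma same_size_transfer:
  assumes "same_size X' Y'" "eventually (\<lambda>k. X k = X' k) U" "eventually (\<lambda>k. Y k = Y' k) U"
  shows "same_size X Y"
  using assms(1) has_size_cong[OF assms(2)] has_size_cong[OF assms(3)]
  unfolding same_size_def by simp

lemma has_size_diff:
  assumes "has_size X c p" "has_size Y c' p'" "\<And>k. Z k = X k - Y k" "\<And>k. Y k \<subseteq> X k" "\<And>k. X k \<subseteq> V k"
  shows "has_size Z (c - c') (p - p')"
  using assms(1,2) regular_graph unfolding has_size_def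
proof eventually_elim
  case (elim k)
  have "finite (X k)" using finite_subset[OF assms(5)] regular_graph.fin elim(3) by blast
  then have "card (Y k) \<le> card (X k)" "card (Z k) = card (X k) - card (Y k)"
    using assms(3,4) card_mono card_Diff_subset finite_subset by metis+
  then show ?case using elim by (simp add: algebra_simps of_nat_diff)
qed

text \<open>The components of the pairs in \<open>K\<close> form two tuples of the same type; counting over both at
  once makes the size a function of the type.\<close>

definition coherent :: "((nat \<Rightarrow> 'a) \<times> (nat \<Rightarrow> 'a)) set \<Rightarrow> bool" where
  "coherent K \<longleftrightarrow> (\<forall>(a, a')\<in>K. elem a \<and> elem a' \<and> (\<forall>(b, b')\<in>K. \<forall>r. W r a b \<longleftrightarrow> W r a' b'))"

lemma coherentD:
  assumes "coherent K" "(a, a') \<in> K"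
  shows "elem a" "elem a'" "(b, b') \<in> K \<Longrightarrow> W r a b \<longleftrightarrow> W r a' b'"
  using assms unfolding coherent_def by blast+

text \<open>By \<open>W_between\<close>, the relations of \<open>m\<close> to the other elements are
  read off from those of \<open>a\<close> and \<open>b\<close>.\<close>

lemma coherent_insert_between:
  assumes "coherent K" "(a, a') \<in> K" "(b, b') \<in> K" "between i j a b m" "between i j a' b' m'"
  shows "coherent (insert (m, m') K)"
proof -
  have m: "elem m" "elem m'" using assms(4,5) unfolding between_def by auto
  have 1: "W r m c \<longleftrightarrow> W r m' c'" if "(c, c') \<in> K" for r c c'
    using coherentD(3)[OF assms(1,2) that] coherentD(3)[OF assms(1,3) that]
    by (simp add: W_between[OF assms(4)] W_between[OF assms(5)])
  then have 2: "W r c m \<longleftrightarrow> W r c' m'" if "(c, c') \<in> K" for r c c'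
    using W_commute that by blast
  show ?thesis
    unfolding coherent_def using assms(1)[unfolded coherent_def] m 1 2 W_self[OF m(1)] W_self[OF m(2)]
    by blast
qed

text \<open>The selector \<open>g\<close> will be \<open>fst\<close> or \<open>snd\<close>, so that
  one list of conditions describes a set over either tuple.\<close>

definition sols where
  "sols g ps k = {v \<in> V k. \<forall>(c, r)\<in>set ps. (E k ^^ r) (g c k) v}"
  for g :: "(nat \<Rightarrow> 'a) \<times> (nat \<Rightarrow> 'a) \<Rightarrow> nat \<Rightarrow> 'a"

lemma sols_Nil [simp]: "sols g [] k = V k"
  and sols_Cons [simp]: "sols g ((c, r) # ps) k = {v \<in> sols g ps k. (E k ^^ r) (g c k) v}"
  unfolding sols_def by auto

text \<open>Induction on the number of conditions: two balls are disjoint, nested, or meet in one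
  ball around a point between the centres. What remains is everything, a single ball or nothing. The
  case distinction depends on \<open>W\<close> only, so both tuples go through it together.\<close>

lemma same_size_sols:
  assumes "coherent K" "\<And>c r. (c, r) \<in> set ps \<Longrightarrow> c \<in> K"
  shows "same_size (sols fst ps) (sols snd ps)"
  using assms
proof (induction "length ps" arbitrary: K ps rule: less_induct)
  case less
  note coh = coherentD[OF less.prems(1)]
  consider "ps = []" | a a' r where "ps = [((a, a'), r)]"
    | a a' r b b' s qs where "ps = ((a, a'), r) # ((b, b'), s) # qs"
    by (metis list.exhaust prod.exhaust)
  then show ?case
  proof cases
    case 1
    have "has_size V 1 0" unfolding has_size_def by simp
    then show ?thesis using 1 unfolding same_size_def sols_def by auto
  next
    case (2 a a' r)
    have "has_size (\<lambda>k. {v \<in> V k. (E k ^^ r) (b k) v}) 0 (walk_poly r)" if "elem b" for b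
      unfolding has_size_def using regular_graph girth[of "2 * r"] that[unfolded elem_def]
    proof eventually_elim
      case (elim k)
      then have "{v \<in> V k. (E k ^^ r) (b k) v} = {v. (E k ^^ r) (b k) v}"
        using regular_graph.walk_in[OF elim(1)] by blast
      then show ?case using regular_graph.card_walk[OF elim(1,2) _ elim(3), of r] by simp
    qed
    then show ?thesis
      using 2 coh[of a a'] less.prems(2)[of "(a, a')" r] unfolding same_size_def sols_def by auto
  next
    case (3 a a' r b b' s qs)
    have K: "(a, a') \<in> K" "(b, b') \<in> K" "\<And>c r. (c, r) \<in> set qs \<Longrightarrow> c \<in> K"
      using less.prems(2) 3 by auto
    note ab = coh(3)[OF K(1,2)]
    note el = coh(1,2)[OF K(1)] coh(1,2)[OF K(2)]
    show ?thesis
    proof (cases "W (r + s) a b")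
      case False
      have "has_size (\<lambda>k. {}) 0 0" unfolding has_size_def by simp
      then have *: "same_size (\<lambda>k. {}) (\<lambda>k. {})" unfolding same_size_def by blast
      have "eventually (\<lambda>k. sols fst ps k = {}) U"
        by (rule eventually_mono[OF eventually_walks_disjoint[OF False]]) (auto simp: 3)
      moreover have "eventually (\<lambda>k. sols snd ps k = {}) U"
        by (rule eventually_mono[OF eventually_walks_disjoint[OF False[unfolded ab]]]) (auto simp: 3)
      ultimately show ?thesis by (rule same_size_transfer[OF *])
    next
      case True
      \<comment> \<open>The distance of the centres, the same for both tuples.\<close>
      define l where "l = (LEAST l. W l a b)"
      have l: "W l a b" "l \<le> r + s" and min: "\<And>q. q < l \<Longrightarrow> \<not> W q a b"
        unfolding l_def using True by (auto intro: LeastI Least_le dest: not_less_Least)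
      have l': "W l a' b'" "\<And>q. q < l \<Longrightarrow> \<not> W q a' b'" using ab l min by auto
      have even: "even (r + s + l)" by (rule W_parity[OF True l(1)])
      consider "r + l < s" | "s + l < r" | "s \<le> r + l" "r \<le> s + l" by linarith
      then show ?thesis
      proof cases
        case 1
        have "same_size (sols fst (((a, a'), r) # qs)) (sols snd (((a, a'), r) # qs))"
          by (rule less.hyps[OF _ less.prems(1)]) (use 3 K in auto)
        moreover have "eventually (\<lambda>k. sols fst ps k = sols fst (((a, a'), r) # qs) k) U"
          by (rule eventually_mono[OF eventually_walks_subset[OF el(3) l(1), of r s]])
            (use 1 even in \<open>auto simp: 3\<close>)
        moreover have "eventually (\<lambda>k. sols snd ps k = sols snd (((a, a'), r) # qs) k) U"
          by (rule eventually_mono[OF eventually_walks_subset[OF el(4) l'(1), of r s]])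
            (use 1 even in \<open>auto simp: 3\<close>)
        ultimately show ?thesis by (rule same_size_transfer)
      next
        case 2
        have "same_size (sols fst (((b, b'), s) # qs)) (sols snd (((b, b'), s) # qs))"
          by (rule less.hyps[OF _ less.prems(1)]) (use 3 K in auto)
        moreover have "eventually (\<lambda>k. sols fst ps k = sols fst (((b, b'), s) # qs) k) U"
          by (rule eventually_mono[OF eventually_walks_subset[OF el(1) l(1)[unfolded W_commute[of l a]], of s r]])
            (use 2 even in \<open>auto simp: 3\<close>)
        moreover have "eventually (\<lambda>k. sols snd ps k = sols snd (((b, b'), s) # qs) k) U"
          by (rule eventually_mono[OF eventually_walks_subset[OF el(2) l'(1)[unfolded W_commute[of l a']], of s r]])
            (use 2 even in \<open>auto simp: 3\<close>)
        ultimately show ?thesis by (rule same_size_transfer)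
      next
        case mid: 3
        \<comment> \<open>Radius \<open>t\<close> of the intersection and distances
          \<open>i\<close>, \<open>j\<close> of its centre from \<open>a\<close>, \<open>b\<close>:
          the solution of \<open>r = t + i\<close>, \<open>s = t + j\<close>,
          \<open>l = i + j\<close>, integral by parity.\<close>
        define t i j where "t = (r + s - l) div 2" and "i = r - t" and "j = s - t"
        have "2 * t = r + s - l" unfolding t_def using even l(2) by simp
        then have t: "r = t + i" "s = t + j" "l = i + j"
          unfolding i_def j_def using mid l(2) by linarith+
        obtain m where m: "between i j a b m" using ex_between[OF el(1)] l min t by metis
        obtain m' where m': "between i j a' b' m'" using ex_between[OF el(2)] l' t by metis
        have "same_size (sols fst (((m, m'), t) # qs)) (sols snd (((m, m'), t) # qs))"
          by (rule less.hyps[OF _ coherent_insert_between[OF less.prems(1) K(1,2) m m']])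
            (use 3 K in auto)
        moreover have "eventually (\<lambda>k. sols fst ps k = sols fst (((m, m'), t) # qs) k) U"
          by (rule eventually_mono[OF m[unfolded between_def, THEN conjunct2, rule_format, of t]])
            (auto simp: 3 t)
        moreover have "eventually (\<lambda>k. sols snd ps k = sols snd (((m, m'), t) # qs) k) U"
          by (rule eventually_mono[OF m'[unfolded between_def, THEN conjunct2, rule_format, of t]])
            (auto simp: 3 t)
        ultimately show ?thesis by (rule same_size_transfer)
      qed
    qed
  qed
qed

text \<open>Inclusion-exclusion, one negated condition at a time: drop the condition, then subtract
  the part where its positive form holds.\<close>

lemma same_size_sols_neg:
  assumes "coherent K" "fst ` set ps \<subseteq> K" "fst ` set ns \<subseteq> K"
  shows "same_size (\<lambda>k. {v \<in> sols fst ps k. \<forall>(c, r)\<in>set ns. \<not> (E k ^^ r) (fst c k) v})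
                   (\<lambda>k. {v \<in> sols snd ps k. \<forall>(c, r)\<in>set ns. \<not> (E k ^^ r) (snd c k) v})"
  using assms(2,3)
proof (induction ns arbitrary: ps)
  case Nil
  then have "c \<in> K" if "(c, r) \<in> set ps" for c r
    using that by (metis fst_conv image_subset_iff)
  then have "same_size (sols fst ps) (sols snd ps)" by (rule same_size_sols[OF assms(1)])
  then show ?case by simp
next
  case (Cons n ns)
  obtain c r where n: "n = (c, r)" by (cases n)
  let ?S = "\<lambda>g ps k. {v \<in> sols g ps k. \<forall>(c, r)\<in>set ns. \<not> (E k ^^ r) (g c k) v}"
  let ?T = "\<lambda>g k. {v \<in> sols g ps k. \<forall>(c, r)\<in>set (n # ns). \<not> (E k ^^ r) (g c k) v}"
  have K: "fst ` set ps \<subseteq> K" "fst ` set (n # ps) \<subseteq> K" "fst ` set ns \<subseteq> K"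
    using Cons.prems by simp_all
  obtain x p where 1: "has_size (?S fst ps) x p" "has_size (?S snd ps) x p"
    using Cons.IH[OF K(1,3)] unfolding same_size_def by blast
  obtain y q where 2: "has_size (?S fst (n # ps)) y q" "has_size (?S snd (n # ps)) y q"
    using Cons.IH[OF K(2,3)] unfolding same_size_def by blast
  have "has_size (?T fst) (x - y) (p - q)"
    by (rule has_size_diff[OF 1(1) 2(1)]) (auto simp: n sols_def)
  moreover have "has_size (?T snd) (x - y) (p - q)"
    by (rule has_size_diff[OF 1(2) 2(2)]) (auto simp: n sols_def)
  ultimately show ?case unfolding same_size_def by blast
qed

subsection \<open>Back and forth\<close>

text \<open>Countable saturation: at stage \<open>k\<close> realise the strongest of the first \<open>k\<close> conditions
  that can be realised there.\<close>

lemma diagonal_choice: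
  fixes P :: "nat \<Rightarrow> nat \<Rightarrow> 'b \<Rightarrow> bool"
  assumes ex: "\<And>R. eventually (\<lambda>k. \<exists>e. P R k e) U"
    and anti: "\<And>R R' k e. P R' k e \<Longrightarrow> R \<le> R' \<Longrightarrow> P R k e"
  obtains e where "\<And>R. eventually (\<lambda>k. P R k (e k)) U"
proof -
  define M where "M k = Max {R. R \<le> k \<and> (\<exists>e. P R k e)}" for k
  define e where "e k = (SOME e. P (M k) k e)" for k
  have "eventually (\<lambda>k. P R k (e k)) U" for R
    using ex[of R] free[of R]
  proof eventually_elim
    case (elim k)
    have fin: "finite {R. R \<le> k \<and> (\<exists>e. P R k e)}" by simp
    have "M k \<in> {R. R \<le> k \<and> (\<exists>e. P R k e)}"
      unfolding M_def by (rule Max_in[OF fin]) (use elim in blast)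
    then have "P (M k) k (e k)" unfolding e_def by (auto intro: someI_ex)
    moreover have "R \<le> M k" unfolding M_def by (rule Max_ge[OF fin]) (use elim in blast)
    ultimately show ?case using anti by blast
  qed
  then show ?thesis using that by blast
qed

text \<open>Equality and adjacency are the instances \<open>r = 0\<close> and
  \<open>r = 1\<close>.\<close>

definition same_type :: "(nat \<Rightarrow> nat \<Rightarrow> 'a) \<Rightarrow> (nat \<Rightarrow> nat \<Rightarrow> 'a) \<Rightarrow> bool" where
  "same_type \<sigma> \<tau> \<longleftrightarrow> (\<forall>i. elem (\<sigma> i) \<and> elem (\<tau> i)) \<and> (\<forall>i j r. W r (\<sigma> i) (\<sigma> j) \<longleftrightarrow> W r (\<tau> i) (\<tau> j))"

lemma same_type_sym: "same_type \<sigma> \<tau> \<Longrightarrow> same_type \<tau> \<sigma>"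
  unfolding same_type_def by simp

text \<open>For \<open>\<delta>\<close> ranging over the subsets of
  \<open>{..R} \<times> {..R}\<close> these are the atoms generated by finitely many balls.\<close>

definition cell :: "(nat \<Rightarrow> nat \<Rightarrow> 'a) \<Rightarrow> nat \<Rightarrow> (nat \<times> nat) set \<Rightarrow> nat \<Rightarrow> 'a set" where
  "cell \<sigma> R \<delta> k = {v \<in> V k. \<forall>i\<le>R. \<forall>r\<le>R. (E k ^^ r) (\<sigma> i k) v \<longleftrightarrow> (i, r) \<in> \<delta>}"

lemma same_size_cell:
  assumes "same_type \<sigma> \<tau>"
  shows "same_size (cell \<sigma> R \<delta>) (cell \<tau> R \<delta>)"
proof -
  define K where "K = range (\<lambda>i. (\<sigma> i, \<tau> i))"
  define f where "f = (\<lambda>(i, r). ((\<sigma> i, \<tau> i), r :: nat))"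
  have "coherent K" using assms unfolding K_def coherent_def same_type_def by auto
  obtain ps where ps: "set ps = f ` (({..R} \<times> {..R}) \<inter> \<delta>)"
    using finite_list[of "f ` (({..R} \<times> {..R}) \<inter> \<delta>)"] by auto
  obtain ns where ns: "set ns = f ` (({..R} \<times> {..R}) - \<delta>)"
    using finite_list[of "f ` (({..R} \<times> {..R}) - \<delta>)"] by auto
  have "fst ` set ps \<subseteq> K" "fst ` set ns \<subseteq> K"
    unfolding ps ns K_def f_def by auto
  note sz = same_size_sols_neg[OF \<open>coherent K\<close> this]
  have f: "(\<forall>(c, r)\<in>f ` A. Q c r) \<longleftrightarrow> (\<forall>(i, r)\<in>A. Q (\<sigma> i, \<tau> i) r)" for A Q
    unfolding f_def by auto
  have eq: "cell \<rho> R \<delta> k = {v \<in> sols g ps k. \<forall>(c, r)\<in>set ns. \<not> (E k ^^ r) (g c k) v}"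
    if "\<And>i. g (\<sigma> i, \<tau> i) = \<rho> i" for g \<rho> k
    unfolding cell_def sols_def ps ns f that by auto
  have "cell \<sigma> R \<delta> = (\<lambda>k. {v \<in> sols fst ps k. \<forall>(c, r)\<in>set ns. \<not> (E k ^^ r) (fst c k) v})"
    by (rule ext, rule eq) simp
  moreover have "cell \<tau> R \<delta> = (\<lambda>k. {v \<in> sols snd ps k. \<forall>(c, r)\<in>set ns. \<not> (E k ^^ r) (snd c k) v})"
    by (rule ext, rule eq) simp
  ultimately show ?thesis using sz by simp
qed

text \<open>The cell of \<open>v\<close> over \<open>\<sigma>\<close> is nonempty, so by equality of
  sizes the matching cell over \<open>\<tau>\<close> is nonempty. This meets finitely many
  conditions; \<open>diagonal_choice\<close> then meets all of them.\<close>

lemma extend_same_type: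
  assumes st: "same_type \<sigma> \<tau>" and v: "elem v"
  obtains e where "elem e" "\<And>i r. W r (\<sigma> i) v \<longleftrightarrow> W r (\<tau> i) e"
proof -
  define \<delta> where "\<delta> = {(i, r). W r (\<sigma> i) v}"
  define P where "P R k e \<longleftrightarrow> e \<in> cell \<tau> R \<delta> k" for R k e
  have "eventually (\<lambda>k. \<exists>e. P R k e) U" for R
  proof -
    obtain c p where *: "has_size (cell \<sigma> R \<delta>) c p" "has_size (cell \<tau> R \<delta>) c p"
      using same_size_cell[OF st] unfolding same_size_def by blast
    have "eventually (\<lambda>k. \<forall>i\<in>{..R}. \<forall>r\<in>{..R}. (E k ^^ r) (\<sigma> i k) (v k) \<longleftrightarrow> (i, r) \<in> \<delta>) U"
      unfolding \<delta>_def W_def by (intro eventually_ball_finite ballI) (auto intro: eventually_decide)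
    then show ?thesis
      using * v regular_graph unfolding has_size_def elem_def
    proof eventually_elim
      case (elim k)
      have "v k \<in> cell \<sigma> R \<delta> k" using elim unfolding cell_def by auto
      moreover have "finite (cell \<sigma> R \<delta> k)"
        using regular_graph.fin[OF elim(5)] unfolding cell_def by auto
      ultimately have "card (cell \<sigma> R \<delta> k) \<noteq> 0" by auto
      then have "card (cell \<tau> R \<delta> k) \<noteq> 0" using elim by linarith
      then have "cell \<tau> R \<delta> k \<noteq> {}" by auto
      then show ?case unfolding P_def by blast
    qed
  qed
  moreover have "P R k e" if "P R' k e" "R \<le> R'" for R R' k e
    using that unfolding P_def cell_def by auto
  ultimately obtain e where e: "\<And>R. eventually (\<lambda>k. P R k (e k)) U"
    using diagonal_choice[of P] by blast
  have "elem e" using e[of 0] unfolding elem_def P_def cell_def by (auto elim: eventually_mono)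
  moreover have "W r (\<sigma> i) v \<longleftrightarrow> W r (\<tau> i) e" for i r
  proof -
    have "eventually (\<lambda>k. (E k ^^ r) (\<tau> i k) (e k) \<longleftrightarrow> (i, r) \<in> \<delta>) U"
      \<comment> \<open>The first level whose cells decide the pair \<open>(i, r)\<close>.\<close>
      using e[of "max i r"] unfolding P_def cell_def by (auto elim: eventually_mono)
    from eventually_iff_cong[OF this] show ?thesis
      unfolding W_def[symmetric] \<delta>_def using nontrivial by simp
  qed
  ultimately show ?thesis using that by blast
qed

lemma same_type_update:
  assumes "same_type \<sigma> \<tau>" "elem v" "elem e" "\<And>i r. W r (\<sigma> i) v \<longleftrightarrow> W r (\<tau> i) e"
  shows "same_type (\<sigma>(x := v)) (\<tau>(x := e))"
proof -
  have "W r v (\<sigma> i) \<longleftrightarrow> W r e (\<tau> i)" for i r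
    using assms(4) W_commute by blast
  then show ?thesis
    using assms W_self[OF assms(2)] W_self[OF assms(3)]
    unfolding same_type_def by (simp add: fun_upd_def)
qed

text \<open>Atoms are \<open>W 0\<close> and \<open>W 1\<close>, connectives pass through the
  ultrafilter, and a witness of a quantifier is matched by \<open>extend_same_type\<close>.\<close>

lemma sat_same_type:
  assumes "same_type \<sigma> \<tau>"
  shows "eventually (\<lambda>k. sat (V k) (E k) \<phi> (\<lambda>i. \<sigma> i k)) U \<longleftrightarrow>
         eventually (\<lambda>k. sat (V k) (E k) \<phi> (\<lambda>i. \<tau> i k)) U"
  using assms
proof (induction \<phi> arbitrary: \<sigma> \<tau>)
  case (FEq x y)
  then have "W 0 (\<sigma> x) (\<sigma> y) \<longleftrightarrow> W 0 (\<tau> x) (\<tau> y)" unfolding same_type_def by blast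
  then show ?case unfolding W_def by simp
next
  case (FAdj x y)
  then have "W 1 (\<sigma> x) (\<sigma> y) \<longleftrightarrow> W 1 (\<tau> x) (\<tau> y)" unfolding same_type_def by blast
  then show ?case unfolding W_def by (simp add: relpowp_1 del: One_nat_def)
next
  case (FNeg \<phi>)
  then show ?case by (simp add: eventually_not_iff)
next
  case (FConj \<phi> \<psi>)
  then show ?case by (simp add: eventually_conj_iff)
next
  case (FEx x \<phi>)
  have upd: "(\<lambda>i. \<sigma> i k)(x := v k) = (\<lambda>i. (\<sigma>(x := v)) i k)" for \<sigma> :: "nat \<Rightarrow> nat \<Rightarrow> 'a" and v k
    by auto
  have "eventually (\<lambda>k. sat (V k) (E k) (FEx x \<phi>) (\<lambda>i. \<tau> i k)) U"
    if st: "same_type \<sigma> \<tau>" and "eventually (\<lambda>k. sat (V k) (E k) (FEx x \<phi>) (\<lambda>i. \<sigma> i k)) U" for \<sigma> \<tau>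
  proof -
    \<comment> \<open>Witnesses in the single graphs are assembled into one element, as for Los's
      theorem.\<close>
    define v where "v k = (SOME v. v \<in> V k \<and> sat (V k) (E k) \<phi> ((\<lambda>i. \<sigma> i k)(x := v)))" for k
    have v: "eventually (\<lambda>k. v k \<in> V k \<and> sat (V k) (E k) \<phi> ((\<lambda>i. \<sigma> i k)(x := v k))) U"
      using that(2)
    proof eventually_elim
      case (elim k)
      then have "\<exists>v. v \<in> V k \<and> sat (V k) (E k) \<phi> ((\<lambda>i. \<sigma> i k)(x := v))" by auto
      then show ?case unfolding v_def by (rule someI_ex)
    qed
    then have "elem v" unfolding elem_def by (auto elim: eventually_mono)
    then obtain e where e: "elem e" "\<And>i r. W r (\<sigma> i) v \<longleftrightarrow> W r (\<tau> i) e"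
      using extend_same_type[OF st] by blast
    have "eventually (\<lambda>k. sat (V k) (E k) \<phi> (\<lambda>i. (\<sigma>(x := v)) i k)) U"
      using v unfolding upd by (auto elim: eventually_mono)
    then have "eventually (\<lambda>k. sat (V k) (E k) \<phi> (\<lambda>i. (\<tau>(x := e)) i k)) U"
      using FEx.IH[OF same_type_update[OF st \<open>elem v\<close> e]] by blast
    then show ?thesis
      using e(1) unfolding elem_def
    proof eventually_elim
      case (elim k)
      then show ?case unfolding upd[symmetric] by auto
    qed
  qed
  then show ?case using FEx.prems same_type_sym by blast
qed

section \<open>Definable sets as finite unions of cells\<close>

text \<open>If no \<open>R\<close> worked, then for each \<open>R\<close> almost every graph would
  have two points in one cell on which \<open>\<phi>\<close> differs. A diagonal pair shares its
  cell at every level, so its entries have the same type over the parameters, against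
  \<open>sat_same_type\<close>.\<close>

lemma sat_determined_by_cell:
  assumes a: "\<And>i. elem (a i)"
  obtains R where "eventually (\<lambda>k. \<forall>\<delta>. \<forall>v\<in>cell a R \<delta> k. \<forall>w\<in>cell a R \<delta> k.
    sat (V k) (E k) \<phi> (\<lambda>i. if i = 0 then v else a (i - 1) k) \<longrightarrow>
    sat (V k) (E k) \<phi> (\<lambda>i. if i = 0 then w else a (i - 1) k)) U"
proof (rule ccontr)
  let ?S = "\<lambda>k v. sat (V k) (E k) \<phi> (\<lambda>i. if i = 0 then v else a (i - 1) k)"
  define P where "P R k vw \<longleftrightarrow> (\<exists>\<delta>. fst vw \<in> cell a R \<delta> k \<and> snd vw \<in> cell a R \<delta> k) \<and>
    ?S k (fst vw) \<and> \<not> ?S k (snd vw)" for R k vw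
  assume neg: "\<not> thesis"
  have "eventually (\<lambda>k. \<exists>vw. P R k vw) U" for R
  proof -
    have "\<not> eventually (\<lambda>k. \<forall>\<delta>. \<forall>v\<in>cell a R \<delta> k. \<forall>w\<in>cell a R \<delta> k. ?S k v \<longrightarrow> ?S k w) U"
      using that neg by blast
    then have "eventually (\<lambda>k. \<not> (\<forall>\<delta>. \<forall>v\<in>cell a R \<delta> k. \<forall>w\<in>cell a R \<delta> k. ?S k v \<longrightarrow> ?S k w)) U"
      unfolding eventually_not_iff .
    then show ?thesis
    proof (rule eventually_mono)
      fix k assume "\<not> (\<forall>\<delta>. \<forall>v\<in>cell a R \<delta> k. \<forall>w\<in>cell a R \<delta> k. ?S k v \<longrightarrow> ?S k w)"
      then obtain \<delta> v w where "v \<in> cell a R \<delta> k" "w \<in> cell a R \<delta> k" "?S k v" "\<not> ?S k w" by blast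
      then have "P R k (v, w)" unfolding P_def fst_conv snd_conv by blast
      then show "\<exists>vw. P R k vw" ..
    qed
  qed
  moreover have "P R k vw" if "P R' k vw" "R \<le> R'" for R R' k vw
    using that unfolding P_def cell_def by auto
  ultimately obtain vw where vw: "\<And>R. eventually (\<lambda>k. P R k (vw k)) U"
    using diagonal_choice[of P] by blast
  define v w where "v = fst \<circ> vw" and "w = snd \<circ> vw"
  have el: "elem v" "elem w"
    using vw[of 0] unfolding elem_def P_def cell_def v_def w_def by (auto elim: eventually_mono)
  have W: "W r (a i) v \<longleftrightarrow> W r (a i) w" for i r
    unfolding W_def
  proof (rule eventually_iff_cong, rule eventually_mono[OF vw[of "max i r"]])
    fix k assume "P (max i r) k (vw k)"
    then show "(E k ^^ r) (a i k) (v k) \<longleftrightarrow> (E k ^^ r) (a i k) (w k)"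
      unfolding P_def cell_def v_def w_def by auto
  qed
  then have W': "W r v (a i) \<longleftrightarrow> W r w (a i)" for i r
    using W_commute by blast
  \<comment> \<open>Variable 0 is the free one; the parameters are shifted by one.\<close>
  let ?t = "\<lambda>v i. if i = 0 then v else a (i - 1)"
  have "same_type (?t v) (?t w)"
    unfolding same_type_def using a el W W' W_self[OF el(1)] W_self[OF el(2)] by simp
  from sat_same_type[OF this, of \<phi>]
  have "eventually (\<lambda>k. ?S k (v k)) U \<longleftrightarrow> eventually (\<lambda>k. ?S k (w k)) U"
    unfolding if_distribR .
  moreover have "eventually (\<lambda>k. ?S k (v k)) U" "eventually (\<lambda>k. \<not> ?S k (w k)) U"
    by (rule eventually_mono[OF vw[of 0]], unfold P_def v_def w_def comp_apply, blast)+
  ultimately show False unfolding eventually_not_iff by blast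
qed

lemma has_size_UNION:
  assumes "finite D" "\<And>\<delta>. \<delta> \<in> D \<Longrightarrow> \<exists>c p. has_size (X \<delta>) c p"
    and "\<And>\<delta> k. X \<delta> k \<subseteq> V k" "\<And>\<delta> \<delta>' k. \<delta> \<in> D \<Longrightarrow> \<delta>' \<in> D \<Longrightarrow> \<delta> \<noteq> \<delta>' \<Longrightarrow> X \<delta> k \<inter> X \<delta>' k = {}"
  shows "\<exists>c p. has_size (\<lambda>k. \<Union>\<delta>\<in>D. X \<delta> k) c p"
  using assms(1,2,4)
proof (induction D)
  case empty
  have "has_size (\<lambda>k. {}) 0 0" unfolding has_size_def by simp
  then show ?case by auto
next
  case (insert \<delta> D)
  obtain c p where 1: "has_size (X \<delta>) c p" using insert.prems by blast
  obtain c' p' where 2: "has_size (\<lambda>k. \<Union>\<delta>\<in>D. X \<delta> k) c' p'" using insert by blast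
  have "has_size (\<lambda>k. \<Union>\<delta>\<in>insert \<delta> D. X \<delta> k) (c + c') (p + p')"
    using 1 2 regular_graph unfolding has_size_def
  proof eventually_elim
    case (elim k)
    have "finite (X \<delta> k)" for \<delta> using finite_subset[OF assms(3)] regular_graph.fin elim(3) by blast
    moreover have "X \<delta> k \<inter> (\<Union>\<delta>\<in>D. X \<delta> k) = {}" using insert.prems(2) insert.hyps by blast
    ultimately have "card (\<Union>\<delta>\<in>insert \<delta> D. X \<delta> k) = card (X \<delta> k) + card (\<Union>\<delta>\<in>D. X \<delta> k)"
      using insert.hyps by (simp add: card_Un_disjoint)
    then show ?case using elim by (simp add: algebra_simps)
  qed
  then show ?case by blast
qed

theorem ex_size_defset:
  assumes a: "\<And>i. elem (\<lambda>k. a k i)"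
  shows "\<exists>c p. has_size (\<lambda>k. defset (V k) (E k) \<phi> (a k)) c p"
proof -
  let ?S = "\<lambda>k v. sat (V k) (E k) \<phi> (\<lambda>i. if i = 0 then v else a k (i - 1))"
  define b where "b i k = a k i" for i k
  have b: "elem (b i)" for i using a unfolding b_def .
  obtain R where R: "eventually (\<lambda>k. \<forall>\<delta>. \<forall>v\<in>cell b R \<delta> k. \<forall>w\<in>cell b R \<delta> k. ?S k v \<longrightarrow> ?S k w) U"
    using sat_determined_by_cell[where \<phi> = \<phi> and a = b, OF b] unfolding b_def by blast
  define A where "A = Pow ({..R} \<times> {..R})"
  \<comment> \<open>The cells that meet the definable set in almost every graph; by the choice of
    \<open>R\<close> they are contained in it.\<close>
  define D where "D = {\<delta> \<in> A. eventually (\<lambda>k. \<exists>v\<in>cell b R \<delta> k. ?S k v) U}"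
  have finA: "finite A" unfolding A_def by simp
  have cell_unique: "\<delta> = {(i, r). i \<le> R \<and> r \<le> R \<and> (E k ^^ r) (b i k) v}"
    if "\<delta> \<in> A" "v \<in> cell b R \<delta> k" for \<delta> v k
    using that unfolding A_def cell_def by auto
  have disj: "cell b R \<delta> k \<inter> cell b R \<delta>' k = {}" if "\<delta> \<in> A" "\<delta>' \<in> A" "\<delta> \<noteq> \<delta>'" for \<delta> \<delta>' k
  proof (rule ccontr)
    assume "cell b R \<delta> k \<inter> cell b R \<delta>' k \<noteq> {}"
    then obtain v where "v \<in> cell b R \<delta> k" "v \<in> cell b R \<delta>' k" by blast
    then have "\<delta> = \<delta>'"
      by (rule trans[OF cell_unique[OF that(1)] cell_unique[OF that(2), symmetric]])
    with that(3) show False ..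
  qed
  have cover: "\<exists>\<delta>\<in>A. v \<in> cell b R \<delta> k" if "v \<in> V k" for v k
    using that unfolding A_def cell_def
    by (intro bexI[of _ "{(i, r). i \<le> R \<and> r \<le> R \<and> (E k ^^ r) (b i k) v}"]) auto
  have "same_type b b" unfolding same_type_def using b by simp
  then have size: "\<exists>c p. has_size (cell b R \<delta>) c p" for \<delta>
    using same_size_cell[of b b R \<delta>] unfolding same_size_def by blast
  have "D \<subseteq> A" unfolding D_def by auto
  have "\<exists>c p. has_size (\<lambda>k. \<Union>\<delta>\<in>D. cell b R \<delta> k) c p"
  proof (rule has_size_UNION)
    show "finite D" by (rule finite_subset[OF \<open>D \<subseteq> A\<close> finA])
    show "cell b R \<delta> k \<subseteq> V k" for \<delta> k unfolding cell_def by auto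
    show "cell b R \<delta> k \<inter> cell b R \<delta>' k = {}" if "\<delta> \<in> D" "\<delta>' \<in> D" "\<delta> \<noteq> \<delta>'" for \<delta> \<delta>' k
      by (rule disj) (use that \<open>D \<subseteq> A\<close> in auto)
  qed (rule size)
  \<comment> \<open>As there are finitely many cells, one set of the ultrafilter settles membership
    in \<open>D\<close> for all of them.\<close>
  moreover have "eventually (\<lambda>k. \<forall>\<delta>\<in>A. (\<exists>v\<in>cell b R \<delta> k. ?S k v) \<longleftrightarrow> \<delta> \<in> D) U"
    using finA by (intro eventually_ball_finite ballI) (auto simp: D_def intro: eventually_decide)
  then have eq: "eventually (\<lambda>k. defset (V k) (E k) \<phi> (a k) = (\<Union>\<delta>\<in>D. cell b R \<delta> k)) U"
    using R
  proof eventually_elim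
    case (elim k)
    show ?case
    proof (intro equalityI subsetI)
      fix v assume v: "v \<in> defset (V k) (E k) \<phi> (a k)"
      then obtain \<delta> where "\<delta> \<in> A" "v \<in> cell b R \<delta> k" using cover unfolding defset_def by blast
      then show "v \<in> (\<Union>\<delta>\<in>D. cell b R \<delta> k)" using elim(1) v unfolding defset_def by blast
    next
      fix v assume "v \<in> (\<Union>\<delta>\<in>D. cell b R \<delta> k)"
      then obtain \<delta> where \<delta>: "\<delta> \<in> D" "v \<in> cell b R \<delta> k" by blast
      then obtain w where "w \<in> cell b R \<delta> k" "?S k w" using elim(1) \<open>D \<subseteq> A\<close> by blast
      then have "?S k v" using elim(2) \<delta> by blast
      then show "v \<in> defset (V k) (E k) \<phi> (a k)" using \<delta> unfolding defset_def cell_def by simp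
    qed
  qed
  ultimately show ?thesis unfolding has_size_cong[OF eq] by blast
qed

end

section \<open>Passage to an explicit polynomial in two variables\<close>

lemma linear_plus_poly_as_double_sum:
  fixes c :: int and p :: "int poly"
  shows "\<exists>N f. \<forall>x y. c * x + poly p y = (\<Sum>i\<le>N. \<Sum>j\<le>N. f i j * x ^ i * y ^ j)"
proof -
  \<comment> \<open>\<open>Suc\<close> ensures \<open>N \<ge> 1\<close>, which leaves room for the
    term \<open>c * x\<close>; the extra coefficient of \<open>p\<close> is zero.\<close>
  define N where "N = Suc (degree p)"
  define f :: "nat \<Rightarrow> nat \<Rightarrow> int"
    where "f = (\<lambda>i j. if i = 0 then coeff p j else if i = 1 \<and> j = 0 then c else 0)"
  have "c * x + poly p y = (\<Sum>i\<le>N. \<Sum>j\<le>N. f i j * x ^ i * y ^ j)" for x y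
  proof -
    have p: "(\<Sum>j\<le>N. f 0 j * x ^ 0 * y ^ j) = poly p y"
      unfolding N_def f_def poly_altdef by (simp add: coeff_eq_0)
    have "(\<Sum>j\<le>N. f (Suc i) j * x ^ Suc i * y ^ j) = (if i = 0 then c * x else 0)" for i
    proof -
      have "(\<Sum>j\<le>N. f (Suc i) j * x ^ Suc i * y ^ j) = (\<Sum>j\<le>N. if j = 0 then (if i = 0 then c * x else 0) else 0)"
        by (rule sum.cong) (auto simp: f_def)
      then show ?thesis by simp
    qed
    then have "(\<Sum>i\<le>N. \<Sum>j\<le>N. f i j * x ^ i * y ^ j) = poly p y + (\<Sum>i\<le>degree p. if i = 0 then c * x else 0)"
      using p unfolding N_def by (subst sum.atMost_Suc_shift) simp
    then show ?thesis by simp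
  qed
  then show ?thesis by blast
qed

theorem theorem4p9:
  fixes V :: "nat \<Rightarrow> 'a set" and E :: "nat \<Rightarrow> 'a \<Rightarrow> 'a \<Rightarrow> bool" and d :: "nat \<Rightarrow> nat"
    and U :: "nat filter"
  assumes graphs: "\<And>k. simple_graph (V k) (E k)"
    and reg: "\<And>k. regular (V k) (E k) (d k)"
    and deg_inf: "filterlim d at_top sequentially"
    and girth_inf: "\<And>g. eventually (\<lambda>k. girth_greater (V k) (E k) g) sequentially"
    and ultra: "nonprincipal_ultrafilter U"
  shows "\<forall>(\<phi>::fo) (a :: nat \<Rightarrow> nat \<Rightarrow> 'a).
           eventually (\<lambda>k. \<forall>i. a k i \<in> V k) U \<longrightarrow>
           (\<exists>(N::nat) (c :: nat \<Rightarrow> nat \<Rightarrow> int).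
              eventually (\<lambda>k. int (card (defset (V k) (E k) \<phi> (a k)))
                 = (\<Sum>i\<le>N. \<Sum>j\<le>N. c i j * int (card (V k)) ^ i * int (d k) ^ j)) U)"
proof (intro allI impI)
  fix \<phi> and a :: "nat \<Rightarrow> nat \<Rightarrow> 'a"
  assume a: "eventually (\<lambda>k. \<forall>i. a k i \<in> V k) U"
  have dec: "eventually P U \<or> eventually (\<lambda>k. \<not> P k) U" for P
    using ultra unfolding nonprincipal_ultrafilter_def by blast
  have ne: "eventually (\<lambda>k. k \<noteq> n) U" for n
    using ultra dec[of "\<lambda>k. k = n"] unfolding nonprincipal_ultrafilter_def by blast
  have free: "eventually (\<lambda>k. n \<le> k) U" for n
  proof -
    have "eventually (\<lambda>k. \<forall>m\<in>{..<n}. k \<noteq> m) U"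
      using ne by (intro eventually_ball_finite) auto
    then show ?thesis by (rule eventually_mono) (metis lessThan_iff not_less)
  qed
  \<comment> \<open>Final segments belong to \<open>U\<close>, so whatever holds for all large
    \<open>k\<close> holds \<open>U\<close>-almost everywhere.\<close>
  have seq: "eventually P U" if "eventually P sequentially" for P
    using that free unfolding eventually_sequentially by (metis eventually_mono)
  interpret graph_ultraproduct V E d U
  proof
    have "eventually (\<lambda>k. d k \<ge> 1) U"
      using deg_inf unfolding filterlim_at_top by (intro seq) blast
    then show "eventually (\<lambda>k. regular_graph (V k) (E k) (d k)) U"
      by (rule eventually_mono) (simp add: graphs reg regular_graph_def)
  qed (use seq girth_inf dec free ultra in \<open>auto simp: nonprincipal_ultrafilter_def\<close>)
  have "elem (\<lambda>k. a k i)" for i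
    unfolding elem_def using a by (rule eventually_mono) blast
  from ex_size_defset[where a = a and \<phi> = \<phi>, OF this] obtain c p where
    size: "has_size (\<lambda>k. defset (V k) (E k) \<phi> (a k)) c p" by blast
  obtain N f where f: "\<forall>x y. c * x + poly p y = (\<Sum>i\<le>N. \<Sum>j\<le>N. f i j * x ^ i * y ^ j)"
    using linear_plus_poly_as_double_sum by blast
  from size show "\<exists>(N::nat) (c :: nat \<Rightarrow> nat \<Rightarrow> int).
              eventually (\<lambda>k. int (card (defset (V k) (E k) \<phi> (a k)))
                 = (\<Sum>i\<le>N. \<Sum>j\<le>N. c i j * int (card (V k)) ^ i * int (d k) ^ j)) U"
    unfolding has_size_def f[rule_format] by blast
qed

end
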